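(* Let $0<x<1$. Then $$\mathrm{Li}_2(1-x) = \zeta(2) +(\log x) \sum_{n\ge1}\frac{x^n}{n} -\sum_{n\ge1}\frac{x^n}{n^2},$$ $$\mathrm{Li}_3(1-x) = \zeta(3) -\zeta(2) \sum_{n\ge1}\frac{x^n}{n} - (\log x)\sum_{n\ge1}\frac{H_{n-1}}{n} x^n + \sum_{n\ge1} \Big(\frac{H^{(2)}_{n-1}}{n} + \frac{H_{n-1}}{n^2} \Big) x^n,$$ $$\mathrm{Li}_4(1-x) = \zeta(4) -\zeta(3) \sum_{n\ge1}\frac{x^n}{n} +\zeta(2)\sum_{n\ge1}\frac{H_{n-1}}{n} x^n + (\log x)\sum_{n\ge1}\frac{\sum_{i=1}^{n-1} \frac{H_{i-1}}{i}}{n} x^n - \sum_{n\ge1} \bigg(\frac{\sum_{i=1}^{n-1} \big(\frac{H^{(2)}_{i-1}}{i}+\frac{H_{i-1}}{i^2} \big)}{n} +\frac{\sum_{i=1}^{n-1}\frac{H_{i-1}}{i} }{n^2} \bigg) x^n,$$ and for every integer $j\ge 2$ $$\mathrm{Li}_j(1-x) = \zeta(j) +\sum_{i=1}^{j-2}(-1)^i\zeta(j-i)\sum_{n\ge1} \frac{S_{i-1,1,n-1}}{n}x^n+(-1)^j (\log x) \sum_{n\ge1} \frac{S_{j-2,1,n-1}}{n} x^n -(-1)^j \sum_{n\ge1}\Big( \frac{T_{j-2,n-1}}{n} +\frac{S_{j-2,1,n-1}}{n^2} \Big) x^n,$$ where the numbers $T_{j-2,n-1}$ satisfy, for $j\ge3$,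 the recursion $$T_{j-2,n-1} = \sum_{i=1}^{n-1}\Big( \frac{T_{j-3,i-1}}{i} +\frac{S_{j-3,1,i-1}}{i^2}\Big).$$ Moreover, for $p\ge1$, $\ x\,\frac{d}{dx}\mathfrak{S}_{1,p}(x)=\frac{(-\log(1-x))^p}{p!}$; the last sum above, $-(-1)^j \sum_{n\ge1}\big( \frac{T_{j-2,n-1}}{n} +\frac{S_{j-2,1,n-1}}{n^2} \big) x^n$, equals $-\sum_{r=0}^{j-2} \mathfrak{S}_{1,j-r-1}(x)\frac{\log^{r}(1-x)}{r!}$; and consequently, for every $j\ge2$, $$\mathrm{Li}_j(1-x) = \sum_{r=0}^{j-1} \Big( \zeta(j-r) -\mathfrak{S}_{1,j-r-1}(x) \Big) \frac{\log^{r}(1-x)}{r!},$$ wherein the term with $\zeta(1)$ (occurring for $r=j-1$) is dropped, i.e. $\zeta(1)$ is replaced by $0$.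
   Context: $\mathrm{Li}_j(y)=\sum_{n\ge1}\frac{y^n}{n^j}$ is the polylogarithm, $\zeta$ the Riemann zeta function, $H_n=\sum_{k=1}^n\frac1k$, $H_n^{(2)}=\sum_{k=1}^n\frac1{k^2}$ ($H_0=H_0^{(2)}=0$). $S_{r,s,t}:=\sum_{s\le i_1<\dots<i_r\le t}\frac{1}{i_1\cdots i_r}$ (sum over integers), which is $0$ for $r\ge 1$ and $t<r+s-1$; $S_{0,s,t}:=1$ if $t\ge s-1$, and $S_{r,s,t}:=0$ if $r<0$. For $j\ge3$, $T_{j-2,n-1}:=\sum\frac{1}{i_1\cdots i_{j-3}\,k^2}$, the sum being over all integers $1\le i_1<\dots<i_{j-3}\le n-1$ and $1\le k\le n-1$ with $k\ne i_1,\dots,i_{j-3}$; $T_{0,n-1}:=0$. The Nielsen integrals are $\mathfrak{S}_{1,p}(x):=\sum_{n\ge1}\frac{S_{p-1,1,n-1}}{n^2}x^n$ for $p\ge1$, and $\mathfrak{S}_{1,0}(x):=\log x$. *)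

theory Defs
  imports "HOL-Analysis.Analysis"
begin

text \<open>Series over n >= 1; shifting the index keeps the term at n = 0 out of the sum.\<close>

abbreviation sum_ge1 :: "(nat \<Rightarrow> real) \<Rightarrow> real"  (binder "\<Sum>\<^sub>1" 10) where
  "sum_ge1 f \<equiv> (\<Sum>n. f (Suc n))"

definition Li :: "nat \<Rightarrow> real \<Rightarrow> real" where
  "Li j y = (\<Sum>\<^sub>1 n. y ^ n / real n ^ j)"

text \<open>The Riemann zeta function at the integers s >= 2, the only arguments that are needed
  (the series diverges for s <= 1, so no meaning is attached to \<open>zeta 1\<close>).\<close>

definition zeta :: "nat \<Rightarrow> real" where
  "zeta s = (\<Sum>\<^sub>1 n. 1 / real n ^ s)"

text \<open>The harmonic numbers are \<^const>\<open>harm\<close>.\<close>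

definition harm2 :: "nat \<Rightarrow> real" where
  "harm2 n = (\<Sum>k=1..n. 1 / real k ^ 2)"

text \<open>The tuples \<open>s \<le> i\<^sub>1 < \<dots> < i\<^sub>r \<le> t\<close>, as strictly increasing lists of length \<open>r\<close>.\<close>

definition incr_tuples :: "nat \<Rightarrow> nat \<Rightarrow> nat \<Rightarrow> nat list set" where
  "incr_tuples r s t = {is. length is = r \<and> sorted_wrt (<) is \<and> set is \<subseteq> {s..t}}"

text \<open>For \<open>r = 0\<close> the only tuple is the empty one, whose empty product gives the value 1.\<close>

definition S :: "nat \<Rightarrow> nat \<Rightarrow> nat \<Rightarrow> real" where
  "S r s t = (\<Sum>is\<in>incr_tuples r s t. 1 / (\<Prod>i\<leftarrow>is. real i))"

lemma S_0 [simp]: "S 0 s t = 1"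
proof -
  have "incr_tuples 0 s t = {[]}" by (auto simp: incr_tuples_def)
  then show ?thesis by (simp add: S_def)
qed

lemma S_eq_0:
  assumes "r \<ge> 1" and "t + 1 < r + s"
  shows "S r s t = 0"
proof -
  have False if "is \<in> incr_tuples r s t" for "is"
  proof -
    have "distinct is"
      using that by (auto simp: incr_tuples_def strict_sorted_iff)
    then have "r = card (set is)"
      using that by (simp add: incr_tuples_def distinct_card)
    also have "\<dots> \<le> card {s..t}"
      using that by (intro card_mono) (auto simp: incr_tuples_def)
    finally show False using assms by simp
  qed
  then have "incr_tuples r s t = {}" by blast
  then show ?thesis by (simp add: S_def)
qed

text \<open>\<open>T m N\<close> sums over \<open>m - 1\<close> increasing indices and one further index \<open>k\<close>, different from
  all of them, which enters squared.\<close>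

definition T :: "nat \<Rightarrow> nat \<Rightarrow> real" where
  "T m N = (if m = 0 then 0 else
     (\<Sum>(is, k) \<in> {(is, k). is \<in> incr_tuples (m - 1) 1 N \<and> k \<in> {1..N} \<and> k \<notin> set is}.
        1 / ((\<Prod>i\<leftarrow>is. real i) * real k ^ 2)))"

text \<open>The Nielsen integrals with first index 1, as functions of the second index.\<close>

definition nielsen1 :: "nat \<Rightarrow> real \<Rightarrow> real" where
  "nielsen1 p x = (if p = 0 then ln x else (\<Sum>\<^sub>1 n. S (p - 1) 1 (n - 1) / real n ^ 2 * x ^ n))"

end

theory Submission
  imports Defs "HOL-Real_Asymp.Real_Asymp"
begin

text \<open>
  Write \<open>l = ln (1 - x)\<close>. Everything comes from differentiating in \<open>x\<close> and comparing values
  at \<open>x = 0\<close>.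

  The driving fact is \<open>(\<Sum>n\<ge>1. S r 1 (n - 1) / n * x ^ n) = (- l) ^ (r + 1) / (r + 1)!\<close>
  (\<open>pser_S_log\<close>). It holds because \<open>S (r + 1) 1\<close> is the sequence of partial sums of
  \<open>S r 1 (n - 1) / n\<close>: taking partial sums multiplies a power series by \<open>1 / (1 - x)\<close>, moving
  the coefficients up by one and dividing them by the index integrates it, and \<open>(- l) ^ (r + 1) / (r + 1)!\<close> is the iterated integral
  obtained in this way. The Nielsen integrals have one more factor \<open>1 / n\<close> in their
  coefficients, so the derivative of \<open>nielsen1 p\<close> is \<open>(- l) ^ p / (p! x)\<close>, for \<open>p = 0\<close> too.

  For the closed formula put \<open>R\<^sub>k x = (\<Sum>r\<le>k. (zeta (k + 1 - r) - nielsen1 (k - r) x) * l ^ r / r!)\<close>,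
  with \<open>zeta 1\<close> read as \<open>0\<close>. Let \<open>k > 0\<close>. Differentiating the powers of \<open>l\<close> gives
  \<open>- R\<^bsub>k-1\<^esub> x / (1 - x)\<close>; differentiating the Nielsen integrals gives \<open>- 1 / x\<close> times the
  binomial expansion of \<open>(l - l) ^ k / k! = 0\<close>. Since \<open>Li (k + 1) (1 - x)\<close> satisfies the same
  differential recursion, starts at \<open>Li 1 (1 - x) = - ln x = R\<^sub>0 x\<close> and tends to \<open>zeta (k + 1)\<close>
  at \<open>0\<close> for \<open>k > 0\<close>, as \<open>R\<^sub>k\<close> does, the two agree (\<open>Li_reflection\<close>).

  The series with coefficients \<open>T m (n - 1) / n + S m 1 (n - 1) / n\<^sup>2\<close> obeys a recursion of the same
  shape, because \<open>T (m + 1)\<close> is the sequence of partial sums of exactly these coefficients; so it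
  is, up to sign, the convolution of Nielsen integrals with powers of \<open>l\<close>
  (\<open>pser_tail_nielsen\<close>). Substituting this and \<open>pser_S_log\<close> into the closed formula gives the
  expansion for general \<open>j\<close>, and \<open>j = 2, 3, 4\<close> are special cases.
\<close>

section \<open>Power series on the open unit interval\<close>

definition pser :: "(nat \<Rightarrow> real) \<Rightarrow> real \<Rightarrow> real" where
  "pser a x = (\<Sum>n. a n * x ^ n)"

text \<open>Convergence is asked for on the open unit interval only: all series below converge there, and
  this property, unlike a bound on the coefficients, passes to partial sums without change.\<close>

definition conv_unit :: "(nat \<Rightarrow> real) \<Rightarrow> bool" where
  "conv_unit a \<longleftrightarrow> (\<forall>x. \<bar>x\<bar> < 1 \<longrightarrow> summable (\<lambda>n. a n * x ^ n))"

text \<open>The coefficients of the primitive that vanishes at \<open>0\<close>: the coefficient at index \<open>0\<close> is a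
  quotient by \<open>0\<close>, hence \<open>0\<close>.\<close>

definition antideriv :: "(nat \<Rightarrow> real) \<Rightarrow> nat \<Rightarrow> real" where
  "antideriv c n = c (n - 1) / real n"

lemma antideriv_0 [simp]: "antideriv c 0 = 0"
  by (simp add: antideriv_def)

lemma conv_unitD: "conv_unit a \<Longrightarrow> \<bar>x\<bar> < 1 \<Longrightarrow> summable (\<lambda>n. a n * x ^ n)"
  by (simp add: conv_unit_def)

lemma conv_unit_abs_summable:
  assumes "conv_unit a" "\<bar>x\<bar> < 1"
  shows "summable (\<lambda>n. norm (a n * x ^ n))"
proof (rule powser_insidea)
  show "summable (\<lambda>n. a n * ((\<bar>x\<bar> + 1) / 2) ^ n)"
    using assms by (intro conv_unitD) auto
  show "norm x < norm ((\<bar>x\<bar> + 1) / 2)" using assms by simp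
qed

lemma conv_unit_add: "conv_unit a \<Longrightarrow> conv_unit b \<Longrightarrow> conv_unit (\<lambda>n. a n + b n)"
  unfolding conv_unit_def by (auto simp: distrib_right intro: summable_add)

lemma pser_add:
  "conv_unit a \<Longrightarrow> conv_unit b \<Longrightarrow> \<bar>x\<bar> < 1 \<Longrightarrow> pser (\<lambda>n. a n + b n) x = pser a x + pser b x"
  unfolding pser_def by (simp add: distrib_right suminf_add conv_unitD)

lemma conv_unit_divide_index:
  assumes "conv_unit a"
  shows "conv_unit (\<lambda>n. a n / real n)"
  unfolding conv_unit_def
proof (intro allI impI)
  fix x :: real assume x: "\<bar>x\<bar> < 1"
  have "norm (a n / real n * x ^ n) \<le> norm (a n * x ^ n)" for n
  proof -
    have "\<bar>a n / real n\<bar> \<le> \<bar>a n\<bar>" by (cases n) (auto simp: divide_le_eq mult_le_cancel_left1)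
    from mult_right_mono[OF this, of "\<bar>x ^ n\<bar>"] show ?thesis by (simp add: abs_mult)
  qed
  then show "summable (\<lambda>n. a n / real n * x ^ n)"
    by (intro summable_comparison_test'[OF conv_unit_abs_summable[OF assms x]])
qed

lemma conv_unit_shift:
  assumes "conv_unit c"
  shows "conv_unit (\<lambda>n. c (n - 1))"
  unfolding conv_unit_def
proof (intro allI impI)
  fix x :: real assume x: "\<bar>x\<bar> < 1"
  have "summable (\<lambda>n. x * (c n * x ^ n))"
    using assms x by (intro summable_mult conv_unitD)
  then have "summable (\<lambda>n. c (Suc n - 1) * x ^ Suc n)" by (simp add: mult_ac)
  then show "summable (\<lambda>n. c (n - 1) * x ^ n)" by (subst (asm) summable_Suc_iff)
qed

lemma conv_unit_antideriv: "conv_unit c \<Longrightarrow> conv_unit (antideriv c)"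
  unfolding antideriv_def using conv_unit_divide_index[OF conv_unit_shift] .

lemma pser_0 [simp]: "pser a 0 = a 0"
  unfolding pser_def by (rule powser_zero)

text \<open>Together with \<open>pser_partial_sums\<close> below this turns recursions between coefficient sequences
  into differential recursions between functions.\<close>

lemma antideriv_deriv:
  assumes c: "conv_unit c" and x: "\<bar>x\<bar> < 1"
  shows "(pser (antideriv c) has_field_derivative pser c x) (at x)"
proof -
  have "diffs (antideriv c) = c"
    by (auto simp: diffs_def antideriv_def fun_eq_iff)
  moreover have "((\<lambda>z. \<Sum>n. antideriv c n * z ^ n) has_field_derivative
      (\<Sum>n. diffs (antideriv c) n * x ^ n)) (at x)"
    using x by (intro termdiffs_strong'[where K = 1] conv_unitD[OF conv_unit_antideriv[OF c]]) auto
  ultimately show ?thesis by (simp add: pser_def[abs_def])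
qed

text \<open>The bridge from series over \<open>n \<ge> 1\<close> to power series.\<close>

lemma pser_Suc_coeffs:
  assumes a: "conv_unit a" "a 0 = 0" and x: "\<bar>x\<bar> < 1"
  shows "(\<Sum>n. a (Suc n) * x ^ Suc n) = pser a x"
  using suminf_split_head[OF conv_unitD[OF a(1) x]] a(2) by (simp add: pser_def)

text \<open>This is \<open>antideriv_deriv\<close> for the series divided by \<open>x\<close>, whose coefficients are those of
  \<open>a\<close> moved down by one.\<close>

lemma pser_divide_index_deriv:
  assumes a: "conv_unit a" "a 0 = 0" and x: "\<bar>x\<bar> < 1" "x \<noteq> 0"
  shows "(pser (\<lambda>n. a n / real n) has_field_derivative pser a x / x) (at x)"
proof -
  let ?b = "\<lambda>n. a (Suc n)"
  have sm: "summable (\<lambda>n. ?b n * y ^ n)" if y: "\<bar>y\<bar> < 1" for y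
  proof (cases "y = 0")
    case False
    have "summable (\<lambda>n. a (Suc n) * y ^ Suc n)"
      using conv_unitD[OF a(1) y] by (subst summable_Suc_iff)
    then have "summable (\<lambda>n. inverse y * (a (Suc n) * y ^ Suc n))" by (rule summable_mult)
    then show ?thesis using False by (simp add: field_simps)
  qed (auto simp: conv_unit_def intro: summable_0_powser)
  then have b: "conv_unit ?b" by (simp add: conv_unit_def)
  have "antideriv ?b = (\<lambda>n. a n / real n)"
  proof
    show "antideriv ?b n = a n / real n" for n
      by (cases n) (auto simp: antideriv_def)
  qed
  moreover have "pser ?b x = pser a x / x"
  proof -
    have "x * pser ?b x = (\<Sum>n. x * (?b n * x ^ n))"
      unfolding pser_def using sm[OF x(1)] by (rule suminf_mult[symmetric])
    also have "\<dots> = pser a x"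
      by (subst pser_Suc_coeffs[OF a x(1), symmetric]) (simp add: mult_ac)
    finally show ?thesis using x by (simp add: field_simps)
  qed
  ultimately show ?thesis using antideriv_deriv[OF b x(1)] by simp
qed

text \<open>Taking partial sums is the Cauchy product with the geometric series.\<close>

lemma
  assumes b: "conv_unit b"
  shows conv_unit_partial_sums: "conv_unit (\<lambda>n. \<Sum>k\<le>n. b k)"
    and pser_partial_sums: "\<bar>x\<bar> < 1 \<Longrightarrow> pser (\<lambda>n. \<Sum>k\<le>n. b k) x = pser b x / (1 - x)"
proof -
  have sums: "(\<lambda>n. (\<Sum>k\<le>n. b k) * x ^ n) sums (pser b x / (1 - x))" if x: "\<bar>x\<bar> < 1" for x
  proof -
    have "summable (\<lambda>n. norm (x ^ n))"
      using x by (simp add: power_abs summable_geometric)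
    from Cauchy_product_sums[OF conv_unit_abs_summable[OF b x] this]
    have "(\<lambda>n. \<Sum>k\<le>n. b k * x ^ k * x ^ (n - k)) sums (pser b x * (1 / (1 - x)))"
      using x by (simp add: pser_def suminf_geometric)
    moreover have "(\<Sum>k\<le>n. b k * x ^ k * x ^ (n - k)) = (\<Sum>k\<le>n. b k) * x ^ n" for n
      by (simp add: sum_distrib_right mult.assoc flip: power_add)
    ultimately show ?thesis by simp
  qed
  then show "conv_unit (\<lambda>n. \<Sum>k\<le>n. b k)"
    by (auto simp: conv_unit_def intro: sums_summable)
  show "pser (\<lambda>n. \<Sum>k\<le>n. b k) x = pser b x / (1 - x)" if "\<bar>x\<bar> < 1"
    using sums[OF that] by (simp add: pser_def sums_iff)
qed

lemma pser_isCont: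
  assumes a: "conv_unit a" and x: "\<bar>x\<bar> < 1"
  shows "isCont (pser a) x"
proof -
  have "((\<lambda>z. \<Sum>n. a n * z ^ n) has_field_derivative (\<Sum>n. diffs a n * x ^ n)) (at x)"
    using x by (intro termdiffs_strong'[where K = 1] conv_unitD[OF a]) auto
  then show ?thesis unfolding pser_def[abs_def] by (rule DERIV_isCont)
qed

text \<open>The derivatives are required only for \<open>t > 0\<close>, since those of the functions compared later
  contain the factor \<open>1 / t\<close>; continuity at \<open>0\<close> carries the initial value over.\<close>

lemma eq_on_unit_interval:
  fixes f g :: "real \<Rightarrow> real"
  assumes f: "continuous_on {0..<1} f" and g: "continuous_on {0..<1} g"
    and f': "\<And>t. 0 < t \<Longrightarrow> t < 1 \<Longrightarrow> (f has_field_derivative d t) (at t)"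
    and g': "\<And>t. 0 < t \<Longrightarrow> t < 1 \<Longrightarrow> (g has_field_derivative d t) (at t)"
    and 0: "f 0 = g 0" and x: "0 \<le> x" "x < 1"
  shows "f x = g x"
proof (cases "x = 0")
  case False
  have "f x - g x = f 0 - g 0"
  proof (rule DERIV_isconst_end[where f = "\<lambda>t. f t - g t"])
    show "0 < x" using False x by simp
    show "continuous_on {0..x} (\<lambda>t. f t - g t)"
      using x by (intro continuous_on_diff continuous_on_subset[OF f] continuous_on_subset[OF g]) auto
    show "((\<lambda>t. f t - g t) has_field_derivative 0) (at t)" if "0 < t" "t < x" for t
      using DERIV_diff[OF f' g', of t] that x by simp
  qed
  then show ?thesis using 0 by simp
qed (use 0 in simp)

section \<open>Recursions for the harmonic sums\<close>

lemma finite_incr_tuples [simp]: "finite (incr_tuples r s t)"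
  by (rule finite_subset[OF _ finite_lists_length_eq[of "{s..t}" r]])
     (auto simp: incr_tuples_def)

text \<open>A tuple with entries up to \<open>n + 1\<close> either avoids \<open>n + 1\<close> or has it as its last entry.\<close>

lemma incr_tuples_Suc:
  "incr_tuples (Suc r) 1 (Suc n) =
     incr_tuples (Suc r) 1 n \<union> (\<lambda>is. is @ [Suc n]) ` incr_tuples r 1 n"
proof (intro equalityI subsetI)
  fix xs assume xs: "xs \<in> incr_tuples (Suc r) 1 (Suc n)"
  then obtain ys y where xs_eq: "xs = ys @ [y]"
    by (cases xs rule: rev_cases) (auto simp: incr_tuples_def)
  show "xs \<in> incr_tuples (Suc r) 1 n \<union> (\<lambda>is. is @ [Suc n]) ` incr_tuples r 1 n"
    using xs by (cases "y = Suc n")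
      (fastforce simp: xs_eq incr_tuples_def sorted_wrt_append)+
qed (fastforce simp: incr_tuples_def sorted_wrt_append)+

lemma sum_incr_tuples_Suc:
  fixes f :: "nat list \<Rightarrow> real"
  shows "(\<Sum>is\<in>incr_tuples (Suc r) 1 (Suc n). f is) =
    (\<Sum>is\<in>incr_tuples (Suc r) 1 n. f is) + (\<Sum>is\<in>incr_tuples r 1 n. f (is @ [Suc n]))"
proof -
  have "incr_tuples (Suc r) 1 n \<inter> (\<lambda>is. is @ [Suc n]) ` incr_tuples r 1 n = {}"
    by (auto simp: incr_tuples_def)
  then show ?thesis
    unfolding incr_tuples_Suc
    by (subst sum.union_disjoint) (auto simp: sum.reindex inj_on_def)
qed

lemma S_Suc: "S (Suc r) 1 (Suc n) = S (Suc r) 1 n + S r 1 n / real (Suc n)"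
  unfolding S_def sum_incr_tuples_Suc by (simp add: sum_divide_distrib)

lemma T_Suc_eq:
  "T (Suc m) N = (\<Sum>is\<in>incr_tuples m 1 N.
     1 / (\<Prod>i\<leftarrow>is. real i) * (\<Sum>k\<in>{1..N} - set is. 1 / real k ^ 2))"
proof -
  have "{(is, k). is \<in> incr_tuples m 1 N \<and> k \<in> {1..N} \<and> k \<notin> set is}
      = (SIGMA is:incr_tuples m 1 N. {1..N} - set is)" by auto
  then show ?thesis
    by (simp add: T_def sum_distrib_left flip: sum.Sigma)
qed

lemma T_0 [simp]: "T 0 N = 0"
  by (simp add: T_def)

text \<open>The index \<open>n + 1\<close> can be absent, be the last of the increasing indices, or be the index
  that enters squared; these cases give the three summands. They exclude each other because the
  squared index differs from all the others.\<close>

lemma T_Suc: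
  "T (Suc m) (Suc n) = T (Suc m) n + T m n / real (Suc n) + S m 1 n / real (Suc n) ^ 2"
proof -
  define w where "w is = 1 / (\<Prod>i\<leftarrow>is. real i)" for "is"
  define h where "h N is = (\<Sum>k\<in>{1..N} - set is. 1 / real k ^ 2)" for N "is"
  \<comment> \<open>As a new candidate for the squared index, \<open>n + 1\<close> adds a term to the inner sum
     exactly when it is not already the last entry of the tuple.\<close>
  have h_old: "h (Suc n) is = h n is + 1 / real (Suc n) ^ 2" if "is \<in> incr_tuples r 1 n" for r "is"
  proof -
    have "{1..Suc n} - set is = insert (Suc n) ({1..n} - set is)"
      using that by (auto simp: incr_tuples_def)
    then show ?thesis by (simp add: h_def)
  qed
  have h_new: "h (Suc n) (is @ [Suc n]) = h n is" for "is"
  proof -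
    have "{1..Suc n} - set (is @ [Suc n]) = {1..n} - set is" by auto
    then show ?thesis by (simp only: h_def)
  qed
  have T_eq: "T (Suc r) N = (\<Sum>is\<in>incr_tuples r 1 N. w is * h N is)" for r N
    by (simp add: T_Suc_eq w_def h_def)
  have S_eq: "S r 1 N = (\<Sum>is\<in>incr_tuples r 1 N. w is)" for r N
    by (simp add: S_def w_def)
  have old: "(\<Sum>is\<in>incr_tuples r 1 n. w is * h (Suc n) is) = T (Suc r) n + S r 1 n / real (Suc n) ^ 2" for r
    by (simp add: T_eq S_eq h_old distrib_left sum.distrib sum_divide_distrib del: One_nat_def cong: sum.cong)
  show ?thesis
  proof (cases m)
    case 0
    have "incr_tuples 0 1 N = {[]}" for N by (auto simp: incr_tuples_def)
    then show ?thesis using old[of 0] unfolding 0 T_eq[of 0 "Suc n"] by simp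
  next
    case (Suc r)
    have "(\<Sum>is\<in>incr_tuples r 1 n. w (is @ [Suc n]) * h (Suc n) (is @ [Suc n])) = T m n / real (Suc n)"
      unfolding h_new Suc T_eq by (simp add: w_def sum_divide_distrib)
    then show ?thesis
      using old[of m] unfolding T_eq[of m "Suc n"] unfolding Suc sum_incr_tuples_Suc by simp
  qed
qed

lemma S_at_0: "S (Suc r) 1 0 = 0"
  by (rule S_eq_0) auto

lemma T_at_0: "T m 0 = 0"
  by (auto simp: T_def)

text \<open>The coefficients of the series in the expansion of \<open>Li (m + 2) (1 - x)\<close> that is multiplied by
  neither \<open>ln x\<close> nor a zeta value; the second summand is \<open>S m 1 (n - 1) / n\<^sup>2\<close>.\<close>

definition tail_coeff :: "nat \<Rightarrow> nat \<Rightarrow> real" where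
  "tail_coeff m n = antideriv (T m) n + antideriv (S m 1) n / real n"

lemma S_partial_sums: "S (Suc r) 1 n = (\<Sum>k\<le>n. antideriv (S r 1) k)"
proof (induction n)
  case (Suc n)
  then show ?case using S_Suc[of r n] by (simp add: antideriv_def)
qed (simp add: S_at_0 del: One_nat_def)

lemma T_partial_sums: "T (Suc m) n = (\<Sum>k\<le>n. tail_coeff m k)"
proof (induction n)
  case (Suc n)
  then show ?case using T_Suc[of m n] by (simp add: tail_coeff_def antideriv_def power2_eq_square)
qed (simp add: T_at_0 tail_coeff_def)


lemma conv_unit_S: "conv_unit (S r 1)"
proof (induction r)
  case 0
  then show ?case by (simp add: conv_unit_def summable_geometric)
next
  case (Suc r)
  have "S (Suc r) 1 = (\<lambda>n. \<Sum>k\<le>n. antideriv (S r 1) k)"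
    by (rule ext) (rule S_partial_sums)
  then show ?case using conv_unit_partial_sums[OF conv_unit_antideriv[OF Suc]] by simp
qed

lemma conv_unit_nielsen: "conv_unit (\<lambda>n. antideriv (S m 1) n / real n)"
  by (intro conv_unit_divide_index conv_unit_antideriv conv_unit_S)

lemma conv_unit_T: "conv_unit (T m)"
  and conv_unit_tail: "conv_unit (tail_coeff m)"
proof -
  have step: "conv_unit (tail_coeff m)" if "conv_unit (T m)" for m
    unfolding tail_coeff_def[abs_def]
    by (intro conv_unit_add conv_unit_nielsen conv_unit_antideriv that)
  show T: "conv_unit (T m)"
  proof (induction m)
    case (Suc m)
    have "T (Suc m) = (\<lambda>n. \<Sum>k\<le>n. tail_coeff m k)" by (rule ext) (rule T_partial_sums)
    then show ?case using conv_unit_partial_sums[OF step[OF Suc]] by simp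
  qed (simp add: conv_unit_def)
  show "conv_unit (tail_coeff m)" by (rule step[OF T])
qed

section \<open>Convolutions with powers of the logarithm\<close>

definition log_term :: "nat \<Rightarrow> real \<Rightarrow> real" where
  "log_term r x = ln (1 - x) ^ r / fact r"

lemma log_term_0 [simp]: "log_term 0 x = 1"
  by (simp add: log_term_def)

lemma log_term_at_0: "log_term r 0 = (if r = 0 then 1 else 0)"
  by (simp add: log_term_def)

lemma log_term_Suc_deriv:
  assumes "x < 1"
  shows "(log_term (Suc r) has_field_derivative - log_term r x / (1 - x)) (at x)"
proof -
  have "((\<lambda>x. ln (1 - x) ^ Suc r / fact (Suc r)) has_field_derivative
     (real (Suc r) * ln (1 - x) ^ r * (- 1 / (1 - x))) / fact (Suc r)) (at x)"
    using assms by (auto intro!: derivative_eq_intros simp del: power_Suc fact_Suc)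
  moreover have "(real (Suc r) * ln (1 - x) ^ r * (- 1 / (1 - x))) / fact (Suc r) = - log_term r x / (1 - x)"
    using assms by (simp add: log_term_def field_simps del: of_nat_Suc)
  ultimately show ?thesis by (simp only: log_term_def[abs_def])
qed

lemma log_term_continuous: "continuous_on {0..<1} (log_term r)"
  unfolding log_term_def[abs_def] by (intro continuous_intros) auto

text \<open>This is the binomial expansion of \<open>(l - l) ^ k / k!\<close> with \<open>l = ln (1 - x)\<close>.\<close>

lemma log_term_alternating_convolution:
  "(\<Sum>r\<le>k. (-1) ^ (k - r) * log_term (k - r) x * log_term r x) = (if k = 0 then 1 else 0)"
proof -
  let ?l = "ln (1 - x)"
  have "(\<Sum>r\<le>k. (-1) ^ (k - r) * log_term (k - r) x * log_term r x)
      = (\<Sum>r\<le>k. of_nat (k choose r) * ?l ^ r * (- ?l) ^ (k - r) / fact k)"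
    by (intro sum.cong refl)
       (simp add: log_term_def binomial_fact field_simps power_minus[of ?l])
  also have "\<dots> = (?l + - ?l) ^ k / fact k"
    unfolding binomial_ring by (simp add: sum_divide_distrib)
  finally show ?thesis by (cases k) auto
qed

text \<open>The Leibniz rule; since the derivative of \<open>log_term (r + 1)\<close> is a multiple of \<open>log_term r\<close>,
  the summands in which a logarithm is differentiated form the same convolution with \<open>k\<close> lowered
  by one.\<close>

lemma log_term_convolution_deriv:
  assumes f: "\<And>p. p \<le> k \<Longrightarrow> (f p has_field_derivative d p) (at x)" and x: "x < 1"
  shows "((\<lambda>t. \<Sum>r\<le>k. f (k - r) t * log_term r t) has_field_derivative
     (\<Sum>r\<le>k. d (k - r) * log_term r x) - (\<Sum>r<k. f (k - 1 - r) x * log_term r x) / (1 - x)) (at x)"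
proof -
  define D where "D r = (if r = 0 then 0 else - log_term (r - 1) x / (1 - x))" for r
  have log_term': "(log_term r has_field_derivative D r) (at x)" for r
  proof (cases r)
    case 0
    have "log_term 0 = (\<lambda>_. 1)" by (simp add: fun_eq_iff)
    then show ?thesis using 0 by (simp add: D_def)
  next
    case (Suc q)
    then show ?thesis using log_term_Suc_deriv[OF x, of q] by (simp add: D_def)
  qed
  have "((\<lambda>t. \<Sum>r\<le>k. f (k - r) t * log_term r t) has_field_derivative
     (\<Sum>r\<le>k. d (k - r) * log_term r x + D r * f (k - r) x)) (at x)"
    by (intro DERIV_sum DERIV_mult f log_term') simp
  moreover have "(\<Sum>r\<le>k. D r * f (k - r) x) = - (\<Sum>r<k. f (k - 1 - r) x * log_term r x) / (1 - x)"
  proof (cases k)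
    case (Suc q)
    show ?thesis
      unfolding Suc sum.atMost_Suc_shift
      by (simp add: D_def lessThan_Suc_atMost sum_negf sum_divide_distrib mult_ac)
  qed (simp add: D_def)
  ultimately show ?thesis by (simp add: sum.distrib)
qed

text \<open>The derivative of the left side is the series of \<open>S r 1\<close>, which is \<open>1 / (1 - x)\<close> times the
  left side for \<open>r - 1\<close>, or times \<open>1\<close> when \<open>r = 0\<close>; the powers of \<open>- ln (1 - x)\<close> satisfy the same recursion.\<close>

lemma pser_S_log:
  assumes "0 \<le> x" "x < 1"
  shows "pser (antideriv (S r 1)) x = (-1) ^ Suc r * log_term (Suc r) x"
  using assms
proof (induction r arbitrary: x rule: less_induct)
  case (less r)
  have S_gen: "pser (S r 1) t = (-1) ^ r * log_term r t / (1 - t)" if t: "0 \<le> t" "t < 1" for t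
  proof (cases r)
    case 0
    then show ?thesis using t by (simp add: pser_def suminf_geometric)
  next
    case (Suc q)
    have "S (Suc q) 1 = (\<lambda>n. \<Sum>k\<le>n. antideriv (S q 1) k)"
      by (rule ext) (rule S_partial_sums)
    then show ?thesis
      using pser_partial_sums[OF conv_unit_antideriv[OF conv_unit_S], of t q] less.IH[of q t] t
      unfolding Suc by simp
  qed
  show ?case
  proof (rule eq_on_unit_interval[where d = "\<lambda>t. (-1) ^ r * log_term r t / (1 - t)"
        and g = "\<lambda>x. (-1) ^ Suc r * log_term (Suc r) x"])
    show "continuous_on {0..<1} (pser (antideriv (S r 1)))"
      by (intro continuous_at_imp_continuous_on ballI pser_isCont conv_unit_antideriv conv_unit_S) auto
    show "continuous_on {0..<1} (\<lambda>x. (-1) ^ Suc r * log_term (Suc r) x)"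
      by (intro continuous_intros log_term_continuous)
    fix t :: real assume t: "0 < t" "t < 1"
    show "(pser (antideriv (S r 1)) has_field_derivative (-1) ^ r * log_term r t / (1 - t)) (at t)"
      using antideriv_deriv[OF conv_unit_S, of t r] S_gen[of t] t by simp
    show "((\<lambda>x. (-1) ^ Suc r * log_term (Suc r) x) has_field_derivative (-1) ^ r * log_term r t / (1 - t)) (at t)"
      using DERIV_cmult[OF log_term_Suc_deriv[OF t(2), of r], of "(-1) ^ Suc r"] by simp
  qed (use less.prems in \<open>simp_all add: log_term_at_0\<close>)
qed

section \<open>Nielsen integrals\<close>

lemma nielsen1_0 [simp]: "nielsen1 0 x = ln x"
  by (simp add: nielsen1_def)

lemma nielsen1_Suc:
  assumes "\<bar>x\<bar> < 1"
  shows "nielsen1 (Suc p) x = pser (\<lambda>n. antideriv (S p 1) n / real n) x"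
  unfolding nielsen1_def
  by (subst pser_Suc_coeffs[OF conv_unit_nielsen _ assms, symmetric])
     (simp_all add: antideriv_def power2_eq_square)

lemma nielsen1_Suc_at_0: "nielsen1 (Suc p) 0 = 0"
  by (simp add: nielsen1_Suc)

lemma nielsen1_Suc_continuous: "continuous_on {0..<1} (nielsen1 (Suc p))"
proof -
  have "continuous_on {0..<1} (pser (\<lambda>n. antideriv (S p 1) n / real n))"
    by (intro continuous_at_imp_continuous_on ballI pser_isCont conv_unit_nielsen) auto
  then show ?thesis by (rule continuous_on_eq) (simp add: nielsen1_Suc)
qed

lemma nielsen1_deriv:
  assumes x: "0 < x" "x < 1"
  shows "(nielsen1 p has_field_derivative (-1) ^ p * log_term p x / x) (at x)"
proof (cases p)
  case 0
  have "nielsen1 0 = ln" by (simp add: nielsen1_def fun_eq_iff)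
  then show ?thesis using x DERIV_ln_divide[of x] by (simp add: 0)
next
  case (Suc q)
  have "(pser (\<lambda>n. antideriv (S q 1) n / real n) has_field_derivative (-1) ^ p * log_term p x / x) (at x)"
    using pser_divide_index_deriv[OF conv_unit_antideriv[OF conv_unit_S], of q x] x
    by (simp add: pser_S_log Suc del: One_nat_def)
  then show ?thesis unfolding Suc
    by (rule has_field_derivative_transform_within_open[where S = "{0<..<1}"])
       (use x in \<open>auto simp: nielsen1_Suc\<close>)
qed

text \<open>Both sides vanish at \<open>0\<close>. Differentiating the part of the left series with \<open>S\<close> gives a power
  of the logarithm over \<open>x\<close>; differentiating the part with \<open>T\<close> gives the series of \<open>T m\<close>, that is,
  \<open>1 / (1 - x)\<close> times the left series for \<open>m - 1\<close>, or \<open>0\<close> when \<open>m = 0\<close>. On the right the derivative has the same shape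
  by \<open>log_term_convolution_deriv\<close>.\<close>

lemma pser_tail_nielsen:
  assumes "0 \<le> x" "x < 1"
  shows "(-1) ^ m * pser (tail_coeff m) x = (\<Sum>r\<le>m. nielsen1 (Suc (m - r)) x * log_term r x)"
  using assms
proof (induction m arbitrary: x rule: less_induct)
  case (less m)
  define G where "G = (\<lambda>x. \<Sum>r\<le>m. nielsen1 (Suc (m - r)) x * log_term r x)"
  define g where "g = (\<lambda>x. \<Sum>r<m. nielsen1 (Suc (m - 1 - r)) x * log_term r x)"
  have T_gen: "(-1) ^ m * pser (T m) t = - g t / (1 - t)" if t: "0 < t" "t < 1" for t
  proof (cases m)
    case 0
    have "T 0 = (\<lambda>_. 0)" by (simp add: fun_eq_iff)
    then show ?thesis by (simp add: 0 g_def pser_def)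
  next
    case (Suc q)
    have "T (Suc q) = (\<lambda>n. \<Sum>k\<le>n. tail_coeff q k)" by (rule ext) (rule T_partial_sums)
    then have "pser (T (Suc q)) t = pser (tail_coeff q) t / (1 - t)"
      using pser_partial_sums[OF conv_unit_tail, of t q] t by simp
    then show ?thesis using less.IH[of q t] t by (simp add: Suc g_def lessThan_Suc_atMost)
  qed
  have "(-1) ^ m * pser (tail_coeff m) x = G x"
  proof (rule eq_on_unit_interval[where f = "\<lambda>x. (-1) ^ m * pser (tail_coeff m) x"
        and d = "\<lambda>t. - g t / (1 - t) - log_term (Suc m) t / t"])
    show "continuous_on {0..<1} (\<lambda>x. (-1) ^ m * pser (tail_coeff m) x)"
      by (intro continuous_intros continuous_at_imp_continuous_on ballI pser_isCont conv_unit_tail) auto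
    show "continuous_on {0..<1} G"
      unfolding G_def by (intro continuous_intros nielsen1_Suc_continuous log_term_continuous)
    show "(-1) ^ m * pser (tail_coeff m) 0 = G 0"
      by (simp add: G_def tail_coeff_def nielsen1_Suc_at_0)
    fix t :: real assume t: "0 < t" "t < 1"
    have "((\<lambda>x. pser (antideriv (T m)) x + pser (\<lambda>n. antideriv (S m 1) n / real n) x)
        has_field_derivative pser (T m) t + (-1) ^ Suc m * log_term (Suc m) t / t) (at t)"
      using pser_divide_index_deriv[OF conv_unit_antideriv[OF conv_unit_S], of m t] t
      by (intro DERIV_add antideriv_deriv conv_unit_T) (auto simp: pser_S_log simp del: One_nat_def)
    then have "(pser (tail_coeff m) has_field_derivative pser (T m) t + (-1) ^ Suc m * log_term (Suc m) t / t) (at t)"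
      by (rule has_field_derivative_transform_within_open[where S = "{0<..<1}"])
         (use t in \<open>auto simp: tail_coeff_def[abs_def] pser_add conv_unit_antideriv conv_unit_T conv_unit_nielsen
                     simp del: One_nat_def\<close>)
    from DERIV_cmult[OF this, of "(-1) ^ m"]
    show "((\<lambda>x. (-1) ^ m * pser (tail_coeff m) x) has_field_derivative
      - g t / (1 - t) - log_term (Suc m) t / t) (at t)"
      using T_gen[OF t] by (simp add: right_diff_distrib)
    \<comment> \<open>The derivatives of the Nielsen integrals give the alternating convolution of order
       \<open>m + 1\<close>, which is zero, without its summand for \<open>r = m + 1\<close>.\<close>
    have "(\<Sum>r\<le>m. (-1) ^ Suc (m - r) * log_term (Suc (m - r)) t * log_term r t)
        = (\<Sum>r\<le>m. (-1) ^ (Suc m - r) * log_term (Suc m - r) t * log_term r t)"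
      by (intro sum.cong) (auto simp: Suc_diff_le)
    also have "\<dots> = - log_term (Suc m) t"
      using log_term_alternating_convolution[of "Suc m" t] by simp
    finally have "(\<Sum>r\<le>m. (-1) ^ Suc (m - r) * log_term (Suc (m - r)) t * log_term r t) = - log_term (Suc m) t" .
    then have "(\<Sum>r\<le>m. (-1) ^ Suc (m - r) * log_term (Suc (m - r)) t / t * log_term r t) = - log_term (Suc m) t / t"
      by (simp only: times_divide_eq_left sum_divide_distrib[symmetric])
    then show "(G has_field_derivative - g t / (1 - t) - log_term (Suc m) t / t) (at t)"
      using log_term_convolution_deriv[where k = m and f = "\<lambda>p. nielsen1 (Suc p)", OF nielsen1_deriv[OF t] t(2)]
      unfolding G_def g_def by (simp add: minus_diff_commute)
  qed (use less.prems in auto)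
  then show ?case by (simp add: G_def)
qed

section \<open>The polylogarithm at \<open>1 - x\<close>\<close>

lemma conv_unit_Li: "conv_unit (\<lambda>n. 1 / real n ^ Suc k)"
proof (induction k)
  case 0
  then show ?case using conv_unit_antideriv[OF conv_unit_S[of 0]] by (simp add: antideriv_def[abs_def])
next
  case (Suc k)
  from conv_unit_divide_index[OF this] show ?case by (simp add: mult_ac)
qed

lemma Li_pser:
  assumes "\<bar>y\<bar> < 1"
  shows "Li (Suc k) y = pser (\<lambda>n. 1 / real n ^ Suc k) y"
  unfolding Li_def by (subst pser_Suc_coeffs[OF conv_unit_Li _ assms, symmetric]) simp_all

lemma Li_1:
  assumes "0 < y" "y < 1"
  shows "Li 1 y = - ln (1 - y)"
proof -
  have "antideriv (S 0 1) = (\<lambda>n. 1 / real n ^ Suc 0)" by (simp add: antideriv_def fun_eq_iff)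
  then show ?thesis using Li_pser[of y 0] pser_S_log[of y 0] assms by (simp add: log_term_def)
qed

lemma Li_deriv:
  assumes y: "0 < y" "y < 1"
  shows "(Li (Suc (Suc k)) has_field_derivative Li (Suc k) y / y) (at y)"
proof -
  have "(\<lambda>n. 1 / real n ^ Suc k / real n) = (\<lambda>n. 1 / real n ^ Suc (Suc k))"
    by (simp add: mult_ac)
  then have "(pser (\<lambda>n. 1 / real n ^ Suc (Suc k)) has_field_derivative Li (Suc k) y / y) (at y)"
    using pser_divide_index_deriv[OF conv_unit_Li[of k], of y] y by (simp add: Li_pser)
  then show ?thesis
    by (rule has_field_derivative_transform_within_open[where S = "{0<..<1}"])
       (use y in \<open>auto simp: Li_pser\<close>)
qed

text \<open>Continuity up to the endpoint \<open>1\<close>, where the value is \<open>zeta j\<close>, fixes the constant of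
  integration in the reflection formula.\<close>

lemma Li_continuous:
  assumes "j \<ge> 2"
  shows "continuous_on {0..1} (Li j)"
proof -
  have "uniform_limit {0..1} (\<lambda>n y. \<Sum>i<n. y ^ Suc i / real (Suc i) ^ j)
      (\<lambda>y. \<Sum>i. y ^ Suc i / real (Suc i) ^ j) sequentially"
  proof (rule Weierstrass_m_test)
    show "norm (y ^ Suc i / real (Suc i) ^ j) \<le> 1 / real (Suc i) ^ j" if "y \<in> {0..1}" for y i
      using that by (auto simp: power_le_one divide_right_mono simp del: power_Suc of_nat_Suc)
    have "summable (\<lambda>i. 1 / real i ^ j)"
      using inverse_power_summable[of j, where 'a = real] assms by (simp add: inverse_eq_divide)
    then show "summable (\<lambda>i. 1 / real (Suc i) ^ j)" by (subst summable_Suc_iff)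
  qed
  then have "continuous_on {0..1} (\<lambda>y. \<Sum>i. y ^ Suc i / real (Suc i) ^ j)"
    by (rule uniform_limit_theorem[rotated])
       (auto intro!: always_eventually continuous_intros simp del: power_Suc of_nat_Suc)
  then show ?thesis by (simp add: Li_def[abs_def])
qed

text \<open>The product tends to \<open>0\<close> at \<open>0\<close>, and its value there is \<open>0\<close> because \<open>ln 1 = 0\<close>, whatever
  \<open>ln 0\<close> is.\<close>

lemma ln_mult_log_term_Suc_continuous: "continuous_on {0..<1} (\<lambda>t. ln t * log_term (Suc k) t)"
  unfolding continuous_on_eq_continuous_within
proof
  fix t :: real assume t: "t \<in> {0..<1}"
  show "continuous (at t within {0..<1}) (\<lambda>t. ln t * log_term (Suc k) t)"
  proof (cases "t = 0")
    case True
    have "((\<lambda>t::real. ln t * ln (1 - t)) \<longlongrightarrow> 0) (at_right 0)" by real_asymp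
    moreover have "at (0::real) within {0..<1} \<le> at_right 0"
      unfolding at_within_def by (intro inf_mono) auto
    ultimately have "((\<lambda>t::real. ln t * ln (1 - t)) \<longlongrightarrow> 0) (at 0 within {0..<1})"
      by (rule tendsto_mono[rotated])
    moreover have "(log_term k \<longlongrightarrow> log_term k 0) (at 0 within {0..<1})"
      using log_term_continuous[of k] by (simp add: continuous_on_def)
    ultimately have "((\<lambda>t. ln t * ln (1 - t) * log_term k t / real (Suc k)) \<longlongrightarrow> 0 * log_term k 0 / real (Suc k)) (at 0 within {0..<1})"
      by (intro tendsto_intros) auto
    moreover have "(\<lambda>t. ln t * ln (1 - t) * log_term k t / real (Suc k)) = (\<lambda>t. ln t * log_term (Suc k) t)"
      by (simp add: log_term_def field_simps fun_eq_iff)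
    ultimately show ?thesis using True by (simp add: continuous_within)
  next
    case False
    with t show ?thesis unfolding log_term_def by (intro continuous_intros) auto
  qed
qed

text \<open>For \<open>k > 0\<close> both sides have derivative \<open>- Li k (1 - x) / (1 - x)\<close>, the right one by the
  induction hypothesis and \<open>log_term_alternating_convolution\<close>, and both tend to \<open>zeta (k + 1)\<close>
  at \<open>0\<close>. Starting the induction at the elementary case \<open>k = 0\<close>, where \<open>Li 1 (1 - x) = - ln x\<close>,
  is what forces the value \<open>0\<close> in place of \<open>zeta 1\<close>.\<close>

lemma Li_reflection:
  assumes "0 < x" "x < 1"
  shows "Li (Suc k) (1 - x) =
    (\<Sum>r\<le>k. ((if k - r = 0 then 0 else zeta (Suc (k - r))) - nielsen1 (k - r) x) * log_term r x)"
  using assms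
proof (induction k arbitrary: x)
  case 0
  then show ?case using Li_1[of "1 - x"] by (simp add: nielsen1_def)
next
  case (Suc k)
  define f where "f p x = (if p = 0 then 0 else zeta (Suc p)) - nielsen1 p x" for p x
  have f': "(f p has_field_derivative - ((-1) ^ p * log_term p t / t)) (at t)" if "0 < t" "t < 1" for p t
    unfolding f_def using DERIV_diff[OF DERIV_const nielsen1_deriv[OF that, of p]] by simp
  define R where "R x = (\<Sum>r\<le>Suc k. f (Suc k - r) x * log_term r x)" for x
  \<comment> \<open>The last summand is separated because \<open>nielsen1 0 = ln\<close> is not continuous at \<open>0\<close>.\<close>
  have R_split: "R = (\<lambda>x. (\<Sum>r\<le>k. f (Suc (k - r)) x * log_term r x) - ln x * log_term (Suc k) x)"
  proof
    fix x
    have "(\<Sum>r\<le>k. f (Suc k - r) x * log_term r x) = (\<Sum>r\<le>k. f (Suc (k - r)) x * log_term r x)"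
      by (intro sum.cong refl) (simp add: Suc_diff_le)
    then show "R x = (\<Sum>r\<le>k. f (Suc (k - r)) x * log_term r x) - ln x * log_term (Suc k) x"
      by (simp add: R_def f_def)
  qed
  have "Li (Suc (Suc k)) (1 - x) = R x"
  proof (rule eq_on_unit_interval[where d = "\<lambda>t. - Li (Suc k) (1 - t) / (1 - t)"
        and f = "\<lambda>x. Li (Suc (Suc k)) (1 - x)"])
    show "continuous_on {0..<1} (\<lambda>x. Li (Suc (Suc k)) (1 - x))"
      by (rule continuous_on_compose2[OF Li_continuous]) (auto intro!: continuous_intros)
    show "continuous_on {0..<1} R"
      unfolding R_split f_def
      by (intro continuous_intros ln_mult_log_term_Suc_continuous log_term_continuous nielsen1_Suc_continuous)
    fix t :: real assume t: "0 < t" "t < 1"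
    show "((\<lambda>x. Li (Suc (Suc k)) (1 - x)) has_field_derivative - Li (Suc k) (1 - t) / (1 - t)) (at t)"
    proof -
      have "((\<lambda>x. 1 - x) has_field_derivative -1) (at t)"
        by (auto intro!: derivative_eq_intros)
      from DERIV_chain2[where f = "Li (Suc (Suc k))" and g = "\<lambda>x. 1 - x", OF Li_deriv this] t
      show ?thesis by simp
    qed
    have "(\<Sum>r\<le>Suc k. - ((-1) ^ (Suc k - r) * log_term (Suc k - r) t / t) * log_term r t)
        = - (\<Sum>r\<le>Suc k. (-1) ^ (Suc k - r) * log_term (Suc k - r) t * log_term r t) / t"
      by (simp only: sum_divide_distrib sum_negf[symmetric] minus_mult_left times_divide_eq_left minus_divide_left)
    also have "\<dots> = 0" by (simp add: log_term_alternating_convolution del: sum.atMost_Suc)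
    finally have "(\<Sum>r\<le>Suc k. - ((-1) ^ (Suc k - r) * log_term (Suc k - r) t / t) * log_term r t) = 0" .
    moreover have "(\<Sum>r<Suc k. f (Suc k - 1 - r) t * log_term r t) = Li (Suc k) (1 - t)"
      using Suc.IH[OF t] by (simp add: f_def lessThan_Suc_atMost)
    ultimately show "(R has_field_derivative - Li (Suc k) (1 - t) / (1 - t)) (at t)"
      using log_term_convolution_deriv[where k = "Suc k" and f = f, OF f'[OF t] t(2)]
      unfolding R_def[abs_def] by simp
  next
    have "R 0 = (\<Sum>r\<le>k. if r = 0 then f (Suc k) 0 else 0)"
      unfolding R_split by (simp add: log_term_at_0 if_distrib cong: if_cong sum.cong)
    then show "Li (Suc (Suc k)) (1 - 0) = R 0"
      by (simp add: f_def nielsen1_Suc_at_0 Li_def zeta_def)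
  qed (use Suc.prems in auto)
  then show ?case by (simp only: R_def f_def)
qed


section \<open>Expansion in powers of \<open>x\<close> and \<open>ln x\<close>\<close>

lemma S_series:
  assumes "0 < x" "x < 1"
  shows "(\<Sum>\<^sub>1 n. S r 1 (n - 1) / real n * x ^ n) = pser (antideriv (S r 1)) x"
  by (subst pser_Suc_coeffs[OF conv_unit_antideriv[OF conv_unit_S], symmetric])
     (use assms in \<open>auto simp: antideriv_def\<close>)

lemma tail_series:
  assumes "0 < x" "x < 1"
  shows "(\<Sum>\<^sub>1 n. (T m (n - 1) / real n + S m 1 (n - 1) / real n ^ 2) * x ^ n) = pser (tail_coeff m) x"
  by (subst pser_Suc_coeffs[OF conv_unit_tail, symmetric])
     (use assms in \<open>auto simp: tail_coeff_def antideriv_def power2_eq_square\<close>)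

text \<open>Each power of \<open>ln (1 - x)\<close> is replaced by its series from \<open>pser_S_log\<close>; the products of two
  series, a Nielsen integral times a power of the logarithm, collapse into one series by
  \<open>pser_tail_nielsen\<close>.\<close>

lemma Li_reflection_series:
  assumes x: "0 < x" "x < 1"
  shows "Li (Suc (Suc m)) (1 - x) = zeta (Suc (Suc m))
     + (\<Sum>i=1..m. (-1) ^ i * zeta (Suc (Suc m) - i) * pser (antideriv (S (i - 1) 1)) x)
     + (-1) ^ m * ln x * pser (antideriv (S m 1)) x - (-1) ^ m * pser (tail_coeff m) x"
proof -
  have "Li (Suc (Suc m)) (1 - x)
      = (\<Sum>r\<le>m. (zeta (Suc (Suc (m - r))) - nielsen1 (Suc (m - r)) x) * log_term r x) - ln x * log_term (Suc m) x"
    unfolding Li_reflection[OF x] sum.atMost_Suc by (auto simp: Suc_diff_le intro!: sum.cong)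
  also have "\<dots> = (\<Sum>r\<le>m. zeta (Suc (Suc (m - r))) * log_term r x)
      - (-1) ^ m * pser (tail_coeff m) x - ln x * log_term (Suc m) x"
    using x by (simp add: pser_tail_nielsen left_diff_distrib sum_subtractf)
  also have "(\<Sum>r\<le>m. zeta (Suc (Suc (m - r))) * log_term r x)
      = zeta (Suc (Suc m)) + (\<Sum>i=1..m. zeta (Suc (Suc (m - i))) * log_term i x)"
    by (simp add: atMost_atLeast0 sum.atLeast_Suc_atMost)
  also have "(\<Sum>i=1..m. zeta (Suc (Suc (m - i))) * log_term i x)
      = (\<Sum>i=1..m. (-1) ^ i * zeta (Suc (Suc m) - i) * pser (antideriv (S (i - 1) 1)) x)"
  proof (intro sum.cong refl)
    fix i assume i: "i \<in> {1..m}"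
    have "pser (antideriv (S (i - 1) 1)) x = (-1) ^ i * log_term i x"
      using pser_S_log[of x "i - 1"] x i by (cases i) simp_all
    moreover have "Suc (Suc (m - i)) = Suc (Suc m) - i" using i by auto
    ultimately show "zeta (Suc (Suc (m - i))) * log_term i x
        = (-1) ^ i * zeta (Suc (Suc m) - i) * pser (antideriv (S (i - 1) 1)) x"
      by simp
  qed
  also have "log_term (Suc m) x = - ((-1) ^ m * pser (antideriv (S m 1)) x)"
    using x by (simp add: pser_S_log mult.assoc[symmetric] del: One_nat_def flip: power_add mult_2)
  finally show ?thesis by (simp add: mult_ac)
qed

lemma S_Suc_sum: "S (Suc r) 1 n = (\<Sum>i=1..n. S r 1 (i - 1) / real i)"
  unfolding S_partial_sums
  by (simp add: antideriv_def atMost_atLeast0 sum.atLeast_Suc_atMost)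

lemma T_Suc_sum:
  "T (Suc m) n = (\<Sum>i=1..n. T m (i - 1) / real i + S m 1 (i - 1) / real i ^ 2)"
  unfolding T_partial_sums
  by (simp add: tail_coeff_def antideriv_def power2_eq_square atMost_atLeast0 sum.atLeast_Suc_atMost)

lemma S_1_harm: "S 1 1 n = harm n"
  using S_Suc_sum[of 0 n] by (simp add: harm_def inverse_eq_divide)

lemma S_2_harm: "S 2 1 n = (\<Sum>i=1..n. harm (i - 1) / real i)"
  using S_Suc_sum[of 1 n] by (simp only: S_1_harm Suc_1)

lemma T_1_harm2: "T 1 n = harm2 n"
  using T_Suc_sum[of 0 n] by (simp add: harm2_def)

lemma T_2_harm: "T 2 n = (\<Sum>i=1..n. harm2 (i - 1) / real i + harm (i - 1) / real i ^ 2)"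
  using T_Suc_sum[of 1 n] by (simp only: S_1_harm T_1_harm2 Suc_1)

theorem lemma10p1:
  fixes x :: real
  assumes "0 < x" and "x < 1"
  shows
    "Li 2 (1 - x) = zeta 2 + ln x * (\<Sum>\<^sub>1 n. x ^ n / real n) - (\<Sum>\<^sub>1 n. x ^ n / real n ^ 2)
   \<and> Li 3 (1 - x) = zeta 3 - zeta 2 * (\<Sum>\<^sub>1 n. x ^ n / real n)
        - ln x * (\<Sum>\<^sub>1 n. harm (n - 1) / real n * x ^ n)
        + (\<Sum>\<^sub>1 n. (harm2 (n - 1) / real n + harm (n - 1) / real n ^ 2) * x ^ n)
   \<and> Li 4 (1 - x) = zeta 4 - zeta 3 * (\<Sum>\<^sub>1 n. x ^ n / real n)
        + zeta 2 * (\<Sum>\<^sub>1 n. harm (n - 1) / real n * x ^ n)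
        + ln x * (\<Sum>\<^sub>1 n. (\<Sum>i=1..n-1. harm (i - 1) / real i) / real n * x ^ n)
        - (\<Sum>\<^sub>1 n. ((\<Sum>i=1..n-1. harm2 (i - 1) / real i + harm (i - 1) / real i ^ 2) / real n
                   + (\<Sum>i=1..n-1. harm (i - 1) / real i) / real n ^ 2) * x ^ n)
   \<and> (\<forall>j\<ge>2. Li j (1 - x) = zeta j
        + (\<Sum>i=1..j-2. (-1) ^ i * zeta (j - i) * (\<Sum>\<^sub>1 n. S (i - 1) 1 (n - 1) / real n * x ^ n))
        + (-1) ^ j * ln x * (\<Sum>\<^sub>1 n. S (j - 2) 1 (n - 1) / real n * x ^ n)
        - (-1) ^ j * (\<Sum>\<^sub>1 n. (T (j - 2) (n - 1) / real n + S (j - 2) 1 (n - 1) / real n ^ 2) * x ^ n))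
   \<and> (\<forall>j\<ge>3. \<forall>n\<ge>1. T (j - 2) (n - 1)
        = (\<Sum>i=1..n-1. T (j - 3) (i - 1) / real i + S (j - 3) 1 (i - 1) / real i ^ 2))
   \<and> (\<forall>p\<ge>1. nielsen1 p field_differentiable (at x)
        \<and> x * deriv (nielsen1 p) x = (- ln (1 - x)) ^ p / fact p)
   \<and> (\<forall>j\<ge>2. - ((-1) ^ j) * (\<Sum>\<^sub>1 n. (T (j - 2) (n - 1) / real n + S (j - 2) 1 (n - 1) / real n ^ 2) * x ^ n)
        = - (\<Sum>r=0..j-2. nielsen1 (j - r - 1) x * (ln (1 - x) ^ r / fact r)))
   \<and> (\<forall>j\<ge>2. Li j (1 - x)
        = (\<Sum>r=0..j-1. ((if j - r = 1 then 0 else zeta (j - r)) - nielsen1 (j - r - 1) x)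
             * (ln (1 - x) ^ r / fact r)))"
proof (intro conjI allI impI)
  note reflection = Li_reflection_series[OF assms, folded S_series[OF assms] tail_series[OF assms]]
  have S_1: "S (Suc 0) (Suc 0) n = harm n" and T_1: "T (Suc 0) n = harm2 n" for n
    using S_1_harm[of n] T_1_harm2[of n] by simp_all
  show "Li 2 (1 - x) = zeta 2 + ln x * (\<Sum>\<^sub>1 n. x ^ n / real n) - (\<Sum>\<^sub>1 n. x ^ n / real n ^ 2)"
    using reflection[of 0] by (simp add: numeral_2_eq_2)
  show "Li 3 (1 - x) = zeta 3 - zeta 2 * (\<Sum>\<^sub>1 n. x ^ n / real n)
        - ln x * (\<Sum>\<^sub>1 n. harm (n - 1) / real n * x ^ n)
        + (\<Sum>\<^sub>1 n. (harm2 (n - 1) / real n + harm (n - 1) / real n ^ 2) * x ^ n)"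
    using reflection[of 1] by (simp add: S_1 T_1 eval_nat_numeral)
  show "Li 4 (1 - x) = zeta 4 - zeta 3 * (\<Sum>\<^sub>1 n. x ^ n / real n)
        + zeta 2 * (\<Sum>\<^sub>1 n. harm (n - 1) / real n * x ^ n)
        + ln x * (\<Sum>\<^sub>1 n. (\<Sum>i=1..n-1. harm (i - 1) / real i) / real n * x ^ n)
        - (\<Sum>\<^sub>1 n. ((\<Sum>i=1..n-1. harm2 (i - 1) / real i + harm (i - 1) / real i ^ 2) / real n
                   + (\<Sum>i=1..n-1. harm (i - 1) / real i) / real n ^ 2) * x ^ n)"
  proof -
    have "{1..2::nat} = {1, 2}" by auto
    moreover have "Suc (Suc 2) = 4" by simp
    ultimately show ?thesis
      using reflection[of 2] unfolding S_2_harm T_2_harm by (simp add: S_1)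
  qed
next
  fix j :: nat assume "j \<ge> 2"
  then obtain m where j: "j = Suc (Suc m)" by (auto simp: numeral_2_eq_2 dest!: le_Suc_ex)
  show "Li j (1 - x) = zeta j
        + (\<Sum>i=1..j-2. (-1) ^ i * zeta (j - i) * (\<Sum>\<^sub>1 n. S (i - 1) 1 (n - 1) / real n * x ^ n))
        + (-1) ^ j * ln x * (\<Sum>\<^sub>1 n. S (j - 2) 1 (n - 1) / real n * x ^ n)
        - (-1) ^ j * (\<Sum>\<^sub>1 n. (T (j - 2) (n - 1) / real n + S (j - 2) 1 (n - 1) / real n ^ 2) * x ^ n)"
    unfolding S_series[OF assms] tail_series[OF assms]
    using Li_reflection_series[OF assms, of m] by (simp add: j)
  show "- ((-1) ^ j) * (\<Sum>\<^sub>1 n. (T (j - 2) (n - 1) / real n + S (j - 2) 1 (n - 1) / real n ^ 2) * x ^ n)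
        = - (\<Sum>r=0..j-2. nielsen1 (j - r - 1) x * (ln (1 - x) ^ r / fact r))"
  proof -
    have "(\<Sum>r=0..j-2. nielsen1 (j - r - 1) x * (ln (1 - x) ^ r / fact r))
        = (\<Sum>r\<le>m. nielsen1 (Suc (m - r)) x * log_term r x)"
      by (intro sum.cong) (auto simp: j log_term_def Suc_diff_le)
    then show ?thesis
      unfolding tail_series[OF assms] using pser_tail_nielsen[of x m] assms by (simp add: j)
  qed
  show "Li j (1 - x)
        = (\<Sum>r=0..j-1. ((if j - r = 1 then 0 else zeta (j - r)) - nielsen1 (j - r - 1) x)
             * (ln (1 - x) ^ r / fact r))"
    unfolding j Li_reflection[OF assms] atLeast0AtMost
    by (intro sum.cong) (auto simp: log_term_def Suc_diff_le)
next
  fix j n :: nat assume "j \<ge> 3"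
  then obtain m where j: "j = Suc (Suc (Suc m))" by (auto simp: numeral_3_eq_3 dest!: le_Suc_ex)
  then have "j - 2 = Suc m" "j - 3 = m" by simp_all
  then show "T (j - 2) (n - 1)
        = (\<Sum>i=1..n-1. T (j - 3) (i - 1) / real i + S (j - 3) 1 (i - 1) / real i ^ 2)"
    by (simp only: T_Suc_sum)
next
  fix p :: nat
  note deriv = nielsen1_deriv[OF assms, of p]
  then show "nielsen1 p field_differentiable (at x)"
    by (auto simp: field_differentiable_def)
  show "x * deriv (nielsen1 p) x = (- ln (1 - x)) ^ p / fact p"
    using assms by (simp add: DERIV_imp_deriv[OF deriv] log_term_def power_minus[of "ln (1 - x)"])
qed

end
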